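(* Let $K$ be a convex compactum and let $B\subset K$ be a boundary of $K$. If $B$ (with the subspace topology) has a countable network, then $K$ is metrizable.
   Context: A convex compactum is a compact convex subset of a (Hausdorff, real) locally convex linear space. $\mathcal A(K)$ denotes the set of continuous affine functions $f\colon K\to\mathbb R$. A set $B\subset K$ is a boundary of $K$ if every $f\in\mathcal A(K)$ attains its maximum over $K$ at some point of $B$, i.e. there is $b\in B$ with $f(b)=\max_{x\in K}f(x)$. A network of a space $X$ is a family $\mathcal N$ of (arbitrary) subsets of $X$ such that every open subset of $X$ is the union of some subfamily of $\mathcal N$. *)

theory Defs
  imports "HOL-Analysis.Analysis"
begin

text \<open>Hausdorff real locally convex spaces. Continuity of negation, which comes with
  \<^class>\<open>topological_ab_group_add\<close>, already follows from continuity of scalar multiplication.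
  The constant \<^const>\<open>convex\<close> is not available inside a class specification,
  so its definition is written out there.\<close>

class locally_convex_space = real_vector + t2_space + topological_ab_group_add +
  assumes tendsto_scaleR_Pair:
      "LIM x (nhds c \<times>\<^sub>F nhds a). scaleR (fst x) (snd x) :> nhds (scaleR c a)"
    and convex_neighbourhood_0_unfolded:
      "open W \<Longrightarrow> 0 \<in> W \<Longrightarrow> \<exists>U V. open U \<and>
        (\<forall>x\<in>V. \<forall>y\<in>V. \<forall>u\<ge>0. \<forall>v\<ge>0. u + v = 1 \<longrightarrow> scaleR u x + scaleR v y \<in> V) \<and>
        0 \<in> U \<and> U \<subseteq> V \<and> V \<subseteq> W"

lemma convex_neighbourhood_0:
  fixes W :: "'a::locally_convex_space set"
  assumes "open W" "0 \<in> W"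
  shows "\<exists>U V. open U \<and> convex V \<and> 0 \<in> U \<and> U \<subseteq> V \<and> V \<subseteq> W"
  using convex_neighbourhood_0_unfolded[OF assms] unfolding convex_def .

instance real_normed_vector \<subseteq> locally_convex_space
proof
  fix c :: real and a :: 'a
  show "LIM x (nhds c \<times>\<^sub>F nhds a). scaleR (fst x) (snd x) :> nhds (scaleR c a)"
    by (intro tendsto_scaleR filterlim_fst filterlim_snd)
next
  fix W :: "'a set"
  assume "open W" "0 \<in> W"
  then obtain e where "e > 0" "ball 0 e \<subseteq> W"
    by (meson openE)
  then show "\<exists>U V. open U \<and>
        (\<forall>x\<in>V. \<forall>y\<in>V. \<forall>u\<ge>0. \<forall>v\<ge>0. u + v = 1 \<longrightarrow> scaleR u x + scaleR v y \<in> V) \<and>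
        0 \<in> U \<and> U \<subseteq> V \<and> V \<subseteq> W"
    unfolding convex_def[symmetric] by (intro exI[of _ "ball 0 e"]) auto
qed

definition affine_fun_on :: "'a::real_vector set \<Rightarrow> ('a \<Rightarrow> real) \<Rightarrow> bool" where
  "affine_fun_on K f \<longleftrightarrow>
    (\<forall>x\<in>K. \<forall>y\<in>K. \<forall>t\<in>{0..1}. f ((1 - t) *\<^sub>R x + t *\<^sub>R y) = (1 - t) * f x + t * f y)"

text \<open>A function on \<open>K\<close> is represented by a total function whose values outside \<open>K\<close>
  are unconstrained.\<close>

definition continuous_affine_funs :: "'a::{real_vector,topological_space} set \<Rightarrow> ('a \<Rightarrow> real) set" where
  "continuous_affine_funs K = {f. continuous_on K f \<and> affine_fun_on K f}"

definition boundary_of_convex :: "'a::{real_vector,topological_space} set \<Rightarrow> 'a set \<Rightarrow> bool" where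
  "boundary_of_convex K B \<longleftrightarrow>
    B \<subseteq> K \<and> (\<forall>f\<in>continuous_affine_funs K. \<exists>b\<in>B. \<forall>x\<in>K. f x \<le> f b)"

definition network_of :: "'a topology \<Rightarrow> 'a set set \<Rightarrow> bool" where
  "network_of X \<N> \<longleftrightarrow>
    (\<forall>N\<in>\<N>. N \<subseteq> topspace X) \<and> (\<forall>U. openin X U \<longrightarrow> (\<exists>\<M>\<subseteq>\<N>. U = \<Union>\<M>))"

end

(* The key is a Rainwater-Simons theorem: a bounded sequence of continuous affine functions that
   converges pointwise on a boundary B converges pointwise on K. If B has a countable network, then
   every function continuous on B is determined by the countably many pairs (N, [p, q]) of a network
   set and a rational interval with f(N) contained in [p, q]. Picking one element of the unit ball of
   the continuous affine functions for every realizable finite set of such conditions gives a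
   countable set D such that every f in the ball is the limit on B, hence on K, of a sequence in D.
   By Hahn-Banach the ball separates the points of K, so D does too, and D embeds the compact set K
   into a countable power of the real line. *)
theory Submission
  imports Defs
begin

section \<open>Separation of points\<close>

definition sublinear :: "('a::real_vector \<Rightarrow> real) \<Rightarrow> bool" where
  "sublinear q \<longleftrightarrow> (\<forall>x y. q (x + y) \<le> q x + q y) \<and> (\<forall>c>0. \<forall>x. q (c *\<^sub>R x) = c * q x)"

lemma sublinearD:
  assumes "sublinear q"
  shows "q (x + y) \<le> q x + q y" "c > 0 \<Longrightarrow> q (c *\<^sub>R x) = c * q x"
  using assms by (auto simp: sublinear_def)

lemma sublinear_0: "sublinear q \<Longrightarrow> q 0 = 0"
  using sublinearD(2)[of q 2 0] by simp

lemma sublinear_ge_neg: "sublinear q \<Longrightarrow> - q (- x) \<le> q x"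
  using sublinearD(1)[of q x "- x"] sublinear_0[of q] by simp

lemma sublinear_nonneg_scaleR:
  assumes "sublinear q" "c \<ge> 0" shows "q (c *\<^sub>R x) = c * q x"
  using assms sublinearD(2)[of q c x] sublinear_0[of q] by (cases "c = 0") auto

lemma sublinearI:
  assumes "\<And>x y. q (x + y) \<le> q x + q y" "\<And>c x. c > 0 \<Longrightarrow> q (c *\<^sub>R x) \<le> c * q x"
  shows "sublinear q"
  unfolding sublinear_def
proof (intro conjI allI impI antisym)
  fix c :: real and x assume "c > 0"
  then show "c * q x \<le> q (c *\<^sub>R x)"
    using assms(2)[of "inverse c" "c *\<^sub>R x"] by (simp add: field_simps)
qed (use assms in auto)

text \<open>The infimum of q (x + t y) - t q y over t >= 0 is the largest sublinear functional below
  \<open>q\<close> that is at most \<open>- q y\<close> at \<open>- y\<close>. It serves twice for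
  Hahn-Banach: to prescribe the value at \<open>y\<close>, and to show that a minimal functional is
  odd.\<close>

lemma sublinear_directional_inf:
  assumes q: "sublinear q"
  obtains r where "sublinear r" "\<And>x. r x \<le> q x" "r (- y) \<le> - q y"
proof
  let ?F = "\<lambda>x t. q (x + t *\<^sub>R y) - t * q y"
  let ?r = "\<lambda>x. INF t\<in>{0..}. ?F x t"
  \<comment> \<open>Subadditivity for the sum of x + t y and - x gives a lower bound free of t, so
    the infimum is finite.\<close>
  have bound: "- q (- x) \<le> ?F x t" if "t \<ge> 0" for x t
    using sublinearD(1)[OF q, of "x + t *\<^sub>R y" "- x"] sublinear_nonneg_scaleR[OF q that, of y]
    by simp
  then have bdd: "bdd_below (?F x ` {0..})" for x
    by (intro bdd_belowI2[where m = "- q (- x)"]) auto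
  have le: "?r x \<le> ?F x t" if "t \<ge> 0" for x t
    using bdd that by (intro cINF_lower) auto
  show "sublinear ?r"
  proof (rule sublinearI)
    fix u v
    have *: "?r (u + v) \<le> ?F u s + ?F v t" if "s \<ge> 0" "t \<ge> 0" for s t
    proof -
      have "?r (u + v) \<le> ?F (u + v) (s + t)" using that by (intro le) auto
      also have "\<dots> \<le> ?F u s + ?F v t"
        using sublinearD(1)[OF q, of "u + s *\<^sub>R y" "v + t *\<^sub>R y"] by (simp add: algebra_simps)
      finally show ?thesis .
    qed
    have "?r (u + v) - ?F u s \<le> ?r v" if "s \<ge> 0" for s
    proof (rule cINF_greatest)
      show "?r (u + v) - ?F u s \<le> ?F v t" if "t \<in> {0..}" for t
        using *[OF \<open>s \<ge> 0\<close>, of t] that by simp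
    qed simp
    then have "?r (u + v) - ?r v \<le> ?F u s" if "s \<ge> 0" for s
      using that by (simp add: algebra_simps)
    then have "?r (u + v) - ?r v \<le> ?r u"
      by (intro cINF_greatest) auto
    then show "?r (u + v) \<le> ?r u + ?r v" by simp
  next
    fix c :: real and x assume c: "c > 0"
    have "?r (c *\<^sub>R x) / c \<le> ?F x t" if "t \<ge> 0" for t
    proof -
      have "?r (c *\<^sub>R x) \<le> ?F (c *\<^sub>R x) (c * t)" using that c by (intro le) auto
      also have "\<dots> = c * ?F x t"
        using sublinearD(2)[OF q c, of "x + t *\<^sub>R y"] by (simp add: algebra_simps)
      finally show ?thesis using c by (simp add: field_simps)
    qed
    then have "?r (c *\<^sub>R x) / c \<le> ?r x" by (intro cINF_greatest) auto
    then show "?r (c *\<^sub>R x) \<le> c * ?r x" using c by (simp add: field_simps)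
  qed
  show "?r x \<le> q x" for x using le[of 0 x] by simp
  show "?r (- y) \<le> - q y" using le[of 1 "- y"] sublinear_0[OF q] by simp
qed

text \<open>Nearly minimal members at u and at v may differ, but in a chain the smaller of the two
  serves at both points. The minorant \<open>m\<close> keeps the infima finite.\<close>

lemma sublinear_Inf_chain:
  assumes ne: "C \<noteq> {}" and sub: "\<And>q. q \<in> C \<Longrightarrow> sublinear q"
    and bd: "\<And>q x. q \<in> C \<Longrightarrow> m x \<le> q x"
    and chain: "\<And>q r. q \<in> C \<Longrightarrow> r \<in> C \<Longrightarrow> (\<forall>x. q x \<le> r x) \<or> (\<forall>x. r x \<le> q x)"
  shows "sublinear (\<lambda>x. INF q\<in>C. q x)"
proof (rule sublinearI)
  have bdd: "bdd_below ((\<lambda>q. q x) ` C)" for x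
    using bd by (intro bdd_belowI2[where m = "m x"]) auto
  have le: "(INF q\<in>C. q x) \<le> q x" if "q \<in> C" for x q
    using bdd that by (intro cINF_lower) auto
  fix u v
  have "(INF q\<in>C. q (u + v)) \<le> r v + q u" if qr: "q \<in> C" "r \<in> C" for q r
    using chain[OF qr]
  proof
    assume "\<forall>x. q x \<le> r x"
    then show ?thesis using le[OF qr(1), of "u + v"] sublinearD(1)[OF sub[OF qr(1)], of u v]
      by (smt (verit))
  next
    assume "\<forall>x. r x \<le> q x"
    then show ?thesis using le[OF qr(2), of "u + v"] sublinearD(1)[OF sub[OF qr(2)], of u v]
      by (smt (verit))
  qed
  then have "(INF q\<in>C. q (u + v)) - q u \<le> (INF q\<in>C. q v)" if "q \<in> C" for q
    using that ne by (intro cINF_greatest) (auto simp: diff_le_eq)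
  then have "(INF q\<in>C. q (u + v)) - (INF q\<in>C. q v) \<le> (INF q\<in>C. q u)"
    using ne by (intro cINF_greatest) (auto simp: algebra_simps)
  then show "(INF q\<in>C. q (u + v)) \<le> (INF q\<in>C. q u) + (INF q\<in>C. q v)" by simp
next
  have bdd: "bdd_below ((\<lambda>q. q x) ` C)" for x
    using bd by (intro bdd_belowI2[where m = "m x"]) auto
  fix c :: real and x assume c: "c > 0"
  have "(INF q\<in>C. q (c *\<^sub>R x)) / c \<le> q x" if "q \<in> C" for q
    using cINF_lower[OF bdd that, of "c *\<^sub>R x"] sublinearD(2)[OF sub[OF that] c, of x] c
    by (simp add: field_simps)
  then have "(INF q\<in>C. q (c *\<^sub>R x)) / c \<le> (INF q\<in>C. q x)"
    using ne by (intro cINF_greatest) auto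
  then show "(INF q\<in>C. q (c *\<^sub>R x)) \<le> c * (INF q\<in>C. q x)" using c by (simp add: field_simps)
qed

text \<open>Zorn's lemma for the reversed pointwise order: a chain is bounded by its infimum, which
  is finite because every sublinear q below p satisfies - p (- x) <= q x.\<close>

lemma minimal_sublinear:
  assumes p: "sublinear p"
  obtains q where "sublinear q" "\<And>x. q x \<le> p x"
    "\<And>r. sublinear r \<Longrightarrow> (\<And>x. r x \<le> q x) \<Longrightarrow> r = q"
proof -
  define A where "A = {q. sublinear q \<and> (\<forall>x. q x \<le> p x)}"
  let ?P = "\<lambda>q r :: 'a \<Rightarrow> real. \<forall>x. r x \<le> q x"
  have po: "partial_order_on A (relation_of ?P A)"
    by (rule partial_order_on_relation_ofI) (auto intro: order_trans simp: fun_eq_iff intro!: antisym)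
  have "\<exists>u\<in>A. \<forall>q\<in>C. ?P q u" if C: "C \<in> Chains (relation_of ?P A)" for C
  proof (cases "C = {}")
    case True
    with p show ?thesis by (auto simp: A_def)
  next
    case False
    have CA: "q \<in> A" if "q \<in> C" for q
      using C that unfolding Chains_def relation_of_def by fast
    have chain: "(\<forall>x. q x \<le> r x) \<or> (\<forall>x. r x \<le> q x)" if "q \<in> C" "r \<in> C" for q r
      using C that unfolding Chains_def relation_of_def by fast
    have low: "- p (- x) \<le> q x" if "q \<in> C" for q x
    proof -
      have "sublinear q" "q (- x) \<le> p (- x)" using CA[OF that] by (auto simp: A_def)
      with sublinear_ge_neg[of q x] show ?thesis by simp
    qed
    let ?u = "\<lambda>x. INF q\<in>C. q x"
    have le: "?u x \<le> q x" if "q \<in> C" for q x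
      using that low by (intro cINF_lower bdd_belowI2[where m = "- p (- x)"]) auto
    have "sublinear ?u"
      using False chain low CA by (intro sublinear_Inf_chain[where m = "\<lambda>x. - p (- x)"]) (auto simp: A_def)
    moreover have "?u x \<le> p x" for x
    proof -
      obtain q where "q \<in> C" using False by auto
      then have "q x \<le> p x" using CA by (auto simp: A_def)
      with le[OF \<open>q \<in> C\<close>, of x] show ?thesis by simp
    qed
    ultimately show ?thesis using le by (auto simp: A_def intro!: bexI[of _ ?u])
  qed
  from predicate_Zorn[OF po this]
  obtain q where "q \<in> A" and "\<And>r. r \<in> A \<Longrightarrow> \<forall>x. r x \<le> q x \<Longrightarrow> r = q"
    by auto
  then show ?thesis by (intro that[of q]) (auto simp: A_def intro: order_trans)
qed

text \<open>A minimal sublinear functional is odd, since the directional infimum cannot lie strictly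
  below it; being odd and sublinear, it is linear.\<close>

lemma Hahn_Banach_sublinear:
  assumes p: "sublinear p"
  obtains f where "linear f" "\<And>x. f x \<le> p x" "f y = p y"
proof -
  \<comment> \<open>Minimizing below \<open>p'\<close> instead of \<open>p\<close> ensures f (- y)
    <= - p y, which by oddness becomes p y <= f y.\<close>
  obtain p' where p': "sublinear p'" "\<And>x. p' x \<le> p x" "p' (- y) \<le> - p y"
    using sublinear_directional_inf[OF p] by blast
  obtain f where f: "sublinear f" "\<And>x. f x \<le> p' x"
    and min: "\<And>r. sublinear r \<Longrightarrow> (\<And>x. r x \<le> f x) \<Longrightarrow> r = f"
    using minimal_sublinear[OF p'(1)] by blast
  have odd: "f (- x) = - f x" for x
  proof -
    obtain r where "sublinear r" "\<And>z. r z \<le> f z" "r (- x) \<le> - f x"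
      using sublinear_directional_inf[OF f(1)] by blast
    with min[of r] sublinear_ge_neg[OF f(1), of x] show ?thesis by simp
  qed
  have lin: "linear f"
  proof
    fix u v show "f (u + v) = f u + f v"
      using sublinearD(1)[OF f(1), of u v] sublinearD(1)[OF f(1), of "- u" "- v"]
        odd[of "u + v"] odd[of u] odd[of v] by simp
  next
    fix c :: real and u show "f (c *\<^sub>R u) = c *\<^sub>R f u"
    proof (cases "c \<ge> 0")
      case True
      then show ?thesis using sublinear_nonneg_scaleR[OF f(1)] by simp
    next
      case False
      then show ?thesis
        using sublinear_nonneg_scaleR[OF f(1), of "- c" u] odd[of "c *\<^sub>R u"] by simp
    qed
  qed
  have le: "f x \<le> p x" for x using f(2)[of x] p'(2)[of x] by simp
  moreover have "p y \<le> f y" using f(2)[of "- y"] p'(3) odd[of y] by simp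
  ultimately show ?thesis using lin that by (auto intro: antisym)
qed

section \<open>Continuous linear functionals that separate points\<close>

text \<open>The functional is the infimum of the t > 0 with x / t in V. Convexity gives
  subadditivity, and convexity together with 0 in V gives the lower bound 1 off V.\<close>

lemma Minkowski_functional:
  assumes conv: "convex V" and abs: "\<And>x. \<exists>t>0. (1 / t) *\<^sub>R x \<in> V"
  obtains p where "sublinear p" "\<And>x. x \<in> V \<Longrightarrow> p x \<le> 1" "\<And>x. x \<notin> V \<Longrightarrow> p x \<ge> 1"
proof
  define T where "T x = {t. t > 0 \<and> (1 / t) *\<^sub>R x \<in> V}" for x
  let ?p = "\<lambda>x. Inf (T x)"
  have ne: "T x \<noteq> {}" for x using abs by (auto simp: T_def)
  have le: "?p x \<le> t" if "t \<in> T x" for x t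
    using that by (intro cInf_lower bdd_belowI[where m = 0]) (auto simp: T_def)
  have zero: "0 \<in> V" using abs[of 0] by simp
  show "sublinear ?p"
  proof (rule sublinearI)
    fix x y
    have "?p (x + y) \<le> t + s" if s: "s \<in> T x" and t: "t \<in> T y" for s t
    proof (rule le)
      \<comment> \<open>These weights turn the convex combination of x / s and y / t into (x + y) /
        (s + t).\<close>
      have "(s / (s + t)) *\<^sub>R ((1 / s) *\<^sub>R x) + (t / (s + t)) *\<^sub>R ((1 / t) *\<^sub>R y) \<in> V"
        using s t by (intro convexD[OF conv]) (auto simp: T_def add_divide_distrib[symmetric])
      moreover have "(s / (s + t)) *\<^sub>R ((1 / s) *\<^sub>R x) + (t / (s + t)) *\<^sub>R ((1 / t) *\<^sub>R y)
          = (1 / (s + t)) *\<^sub>R (x + y)"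
        using s t by (simp add: T_def scaleR_add_right)
      ultimately show "t + s \<in> T (x + y)" using s t by (simp add: T_def add.commute)
    qed
    then have "?p (x + y) - s \<le> ?p y" if "s \<in> T x" for s
      using that ne by (intro cInf_greatest) (auto simp: diff_le_eq)
    then have "?p (x + y) - ?p y \<le> ?p x"
      using ne by (intro cInf_greatest) (auto simp: algebra_simps)
    then show "?p (x + y) \<le> ?p x + ?p y" by simp
  next
    fix c :: real and x assume c: "c > 0"
    have "?p (c *\<^sub>R x) / c \<le> t" if "t \<in> T x" for t
      using le[of "c * t" "c *\<^sub>R x"] that c by (simp add: T_def field_simps)
    then have "?p (c *\<^sub>R x) / c \<le> ?p x" using ne by (intro cInf_greatest) auto
    then show "?p (c *\<^sub>R x) \<le> c * ?p x" using c by (simp add: field_simps)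
  qed
  show "?p x \<le> 1" if "x \<in> V" for x using le[of 1 x] that by (simp add: T_def)
  show "?p x \<ge> 1" if "x \<notin> V" for x
  proof (intro cInf_greatest ne)
    fix t assume t: "t \<in> T x"
    show "1 \<le> t"
    proof (rule ccontr)
      assume "\<not> 1 \<le> t"
      then have "t *\<^sub>R ((1 / t) *\<^sub>R x) + (1 - t) *\<^sub>R 0 \<in> V"
        using t zero by (intro convexD[OF conv]) (auto simp: T_def)
      then show False using t \<open>x \<notin> V\<close> by (simp add: T_def)
    qed
  qed
qed

lemma tendsto_scaleR_lcs:
  fixes g :: "'b \<Rightarrow> 'a::locally_convex_space"
  assumes "(f \<longlongrightarrow> c) F" "(g \<longlongrightarrow> a) F"
  shows "((\<lambda>x. f x *\<^sub>R g x) \<longlongrightarrow> c *\<^sub>R a) F"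
  using filterlim_compose[OF tendsto_scaleR_Pair filterlim_Pair[OF assms]] by simp

text \<open>The Minkowski functional p of a convex neighbourhood V of 0 that omits x - y dominates a
  linear f with f (x - y) = p (x - y) >= 1, while f <= 1 on an open set U around 0 inside V makes f
  continuous.\<close>

lemma continuous_linear_functional_separates:
  fixes x y :: "'a::locally_convex_space"
  assumes "x \<noteq> y"
  obtains f :: "'a \<Rightarrow> real" where "linear f" "continuous_on UNIV f" "f x \<noteq> f y"
proof -
  define y0 where "y0 = x - y"
  have "y0 \<noteq> 0" using assms by (simp add: y0_def)
  then obtain W where W: "open W" "0 \<in> W" "y0 \<notin> W"
    using t1_space[of 0 y0] by metis
  then obtain U V where UV: "open U" "convex V" "0 \<in> U" "U \<subseteq> V" "V \<subseteq> W"
    using convex_neighbourhood_0[OF W(1,2)] by metis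
  have "\<exists>t>0. (1 / t) *\<^sub>R z \<in> V" for z
  proof -
    have "((\<lambda>t. (1 / t) *\<^sub>R z) \<longlongrightarrow> 0 *\<^sub>R z) at_top"
      by (intro tendsto_scaleR_lcs tendsto_divide_0[OF tendsto_const] tendsto_const
          filterlim_at_top_imp_at_infinity filterlim_ident)
    then have "\<forall>\<^sub>F t in at_top. (1 / t) *\<^sub>R z \<in> U"
      using UV by (intro topological_tendstoD) auto
    then have "\<forall>\<^sub>F t in at_top. (1 / t) *\<^sub>R z \<in> U \<and> t > 0"
      by (intro eventually_conj eventually_gt_at_top)
    then show ?thesis using UV(4) by (auto dest!: eventually_happens)
  qed
  then obtain p where p: "sublinear p" "\<And>x. x \<in> V \<Longrightarrow> p x \<le> 1" "\<And>x. x \<notin> V \<Longrightarrow> p x \<ge> 1"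
    using Minkowski_functional[OF UV(2)] by blast
  obtain f where f: "linear f" "\<And>x. f x \<le> p x" "f y0 = p y0"
    using Hahn_Banach_sublinear[OF p(1)] by blast
  have fU: "f z \<le> 1" if "z \<in> U" for z using f(2)[of z] p(2)[of z] UV(4) that by auto
  have "(f \<longlongrightarrow> f a) (at a)" for a
  proof (rule tendstoI)
    fix e :: real assume e: "e > 0"
    \<comment> \<open>The factor 2 / e yields f z - f a <= e / 2, hence a strict bound by e. Both
      signs of z - a are treated because U is not assumed symmetric.\<close>
    have "((\<lambda>z. (2 / e) *\<^sub>R (z - a)) \<longlongrightarrow> (2 / e) *\<^sub>R (a - a)) (at a)"
      by (intro tendsto_scaleR_lcs tendsto_intros)
    then have 1: "\<forall>\<^sub>F z in at a. (2 / e) *\<^sub>R (z - a) \<in> U"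
      using UV by (intro topological_tendstoD) auto
    have "((\<lambda>z. (2 / e) *\<^sub>R (a - z)) \<longlongrightarrow> (2 / e) *\<^sub>R (a - a)) (at a)"
      by (intro tendsto_scaleR_lcs tendsto_intros)
    then have 2: "\<forall>\<^sub>F z in at a. (2 / e) *\<^sub>R (a - z) \<in> U"
      using UV by (intro topological_tendstoD) auto
    show "\<forall>\<^sub>F z in at a. dist (f z) (f a) < e"
      using 1 2
    proof eventually_elim
      case (elim z)
      have "(2 / e) * (f z - f a) \<le> 1" "(2 / e) * (f a - f z) \<le> 1"
        using fU[OF elim(1)] fU[OF elim(2)] f(1) by (simp_all add: linear_scale linear_diff diff_divide_distrib)
      then have "2 * (f z - f a) \<le> e" "2 * (f a - f z) \<le> e"
        using e by (simp_all add: field_simps)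
      then show ?case using e by (simp add: dist_real_def abs_less_iff)
    qed
  qed
  then have "continuous_on UNIV f" by (simp add: continuous_on_def)
  moreover have "f x \<noteq> f y"
    using f(3) p(3)[of y0] W(3) UV(5) linear_diff[OF f(1), of x y] unfolding y0_def by fastforce
  ultimately show ?thesis using that f(1) by blast
qed

lemma bounded_continuous_affine_separates:
  fixes K :: "'a::locally_convex_space set"
  assumes K: "compact K" and xy: "x \<in> K" "y \<in> K" "x \<noteq> y"
  obtains f where "f \<in> continuous_affine_funs K" "\<forall>z\<in>K. \<bar>f z\<bar> \<le> 1" "f x \<noteq> f y"
proof -
  obtain l :: "'a \<Rightarrow> real" where l: "linear l" "continuous_on UNIV l" "l x \<noteq> l y"
    using continuous_linear_functional_separates[OF xy(3)] by blast
  have cont: "continuous_on K l" using l(2) by (rule continuous_on_subset) simp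
  then have "bounded (l ` K)"
    using K by (intro compact_imp_bounded compact_continuous_image)
  then obtain c where c: "c > 0" "\<And>z. z \<in> K \<Longrightarrow> \<bar>l z\<bar> \<le> c"
    by (auto simp: bounded_pos)
  show ?thesis
  proof
    show "(\<lambda>z. l z / c) \<in> continuous_affine_funs K"
      using cont c(1) by (auto simp: continuous_affine_funs_def affine_fun_on_def linear_add[OF l(1)]
          linear_scale[OF l(1)] add_divide_distrib intro!: continuous_intros)
    show "\<forall>z\<in>K. \<bar>l z / c\<bar> \<le> 1" using c by (simp add: abs_divide)
    show "l x / c \<noteq> l y / c" using l(3) c(1) by simp
  qed
qed

section \<open>Countable networks\<close>

text \<open>The conditions that g maps N into [p, q] are countably many. Enumerating them lets
  \<open>d n\<close> satisfy those among the first n + 1 that f satisfies, so a sequence, not merely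
  a net, approximates f.\<close>

lemma countable_sequentially_dense_on_countable_network:
  fixes B :: "'a::topological_space set" and \<F> :: "('a \<Rightarrow> real) set"
  assumes count: "countable \<N>" and net: "network_of (top_of_set B) \<N>"
    and cont: "\<And>f. f \<in> \<F> \<Longrightarrow> continuous_on B f"
  obtains D where "countable D" "D \<subseteq> \<F>"
    "\<And>f. f \<in> \<F> \<Longrightarrow> \<exists>d. range d \<subseteq> D \<and> (\<forall>b\<in>B. (\<lambda>n. d n b) \<longlonglongrightarrow> f b)"
proof
  define I where "I = \<N> \<times> (\<rat> :: real set) \<times> (\<rat> :: real set)"
  define P where "P F = {g \<in> \<F>. \<forall>(N, p, q)\<in>F. \<forall>z\<in>N. p \<le> g z \<and> g z \<le> q}" for F
  define D where "D = (\<lambda>F. SOME g. g \<in> P F) ` {F. finite F \<and> F \<subseteq> I \<and> P F \<noteq> {}}"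
  have I: "countable I"
    using count countable_rat unfolding I_def by (intro countable_SIGMA) auto
  have "countable {F. finite F \<and> F \<subseteq> I \<and> P F \<noteq> {}}"
    by (rule countable_subset[OF _ countable_Collect_finite_subset[OF I]]) auto
  then show "countable D" unfolding D_def by (rule countable_image)
  have some: "(SOME g. g \<in> P F) \<in> P F" if "P F \<noteq> {}" for F
    using that by (simp add: some_in_eq)
  then show "D \<subseteq> \<F>" unfolding D_def P_def by blast
  fix f assume f: "f \<in> \<F>"
  define e where "e = from_nat_into I"
  define J where "J = {i \<in> I. case i of (N, p, q) \<Rightarrow> \<forall>z\<in>N. p \<le> f z \<and> f z \<le> q}"
  \<comment> \<open>Intersecting with \<open>J\<close> also discards the junk values of
    \<open>e\<close> when \<open>I\<close> is empty.\<close>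
  define d where "d n = (SOME g. g \<in> P (J \<inter> e ` {..n}))" for n
  have fP: "f \<in> P (J \<inter> e ` {..n})" for n
    using f by (auto simp: P_def J_def)
  then have dP: "d n \<in> P (J \<inter> e ` {..n})" for n
    unfolding d_def by (intro some) auto
  have "range d \<subseteq> D"
    using fP unfolding d_def D_def J_def by blast
  moreover have "(\<lambda>n. d n b) \<longlonglongrightarrow> f b" if b: "b \<in> B" for b
  proof (rule tendstoI)
    fix \<epsilon> :: real assume "\<epsilon> > 0"
    \<comment> \<open>With rationals strictly around f b, the point b lies in the open set where p <
      f < q. A network member N around b inside it gives a condition in \<open>J\<close> that pins d
      n b within \<epsilon> of f b for large n.\<close>
    then obtain p q where pq: "p \<in> \<rat>" "f b - \<epsilon> < p" "p < f b" "q \<in> \<rat>" "f b < q" "q < f b + \<epsilon>"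
      using Rats_dense_in_real[of "f b - \<epsilon>" "f b"] Rats_dense_in_real[of "f b" "f b + \<epsilon>"] by auto
    have "openin (top_of_set B) (B \<inter> f -` {p<..<q})"
      using cont[OF f] by (intro continuous_openin_preimage_gen) auto
    with net have "\<exists>M\<subseteq>\<N>. B \<inter> f -` {p<..<q} = \<Union>M"
      unfolding network_of_def by (elim conjE allE impE)
    then obtain M where M: "M \<subseteq> \<N>" "B \<inter> f -` {p<..<q} = \<Union>M" by metis
    have "b \<in> B \<inter> f -` {p<..<q}" using b pq by simp
    then obtain N where N: "N \<in> M" "b \<in> N" unfolding M(2) by blast
    have "N \<in> \<N>" using N(1) M(1) by blast
    moreover have "\<forall>z\<in>N. p \<le> f z \<and> f z \<le> q"
    proof
      fix z assume "z \<in> N"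
      then have "z \<in> B \<inter> f -` {p<..<q}" using N(1) unfolding M(2) by blast
      then show "p \<le> f z \<and> f z \<le> q" by simp
    qed
    ultimately have J: "(N, p, q) \<in> J"
      using pq by (simp add: J_def I_def)
    then have "(N, p, q) \<in> range e"
      using subset_range_from_nat_into[OF I] unfolding J_def e_def by blast
    then obtain k where k: "e k = (N, p, q)" by (metis rangeE)
    have "dist (d n b) (f b) < \<epsilon>" if "n \<ge> k" for n
    proof -
      have "(N, p, q) \<in> J \<inter> e ` {..n}" using J k that by force
      then have "p \<le> d n b \<and> d n b \<le> q" using dP[of n] N(2) unfolding P_def by fast
      then show ?thesis using pq by (simp add: dist_real_def abs_less_iff)
    qed
    then show "\<forall>\<^sub>F n in sequentially. dist (d n b) (f b) < \<epsilon>"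
      by (auto simp: eventually_sequentially)
  qed
  ultimately show "\<exists>d. range d \<subseteq> D \<and> (\<forall>b\<in>B. (\<lambda>n. d n b) \<longlonglongrightarrow> f b)" by blast
qed

text \<open>The enumerated family is a continuous injection of K into the space of real sequences,
  hence by compactness a homeomorphism onto a metrizable image.\<close>

lemma metrizable_of_countable_separating:
  fixes K :: "'a::topological_space set" and D :: "('a \<Rightarrow> real) set"
  assumes K: "compact K" and D: "countable D" "\<And>d. d \<in> D \<Longrightarrow> continuous_on K d"
    and sep: "\<And>x y. x \<in> K \<Longrightarrow> y \<in> K \<Longrightarrow> x \<noteq> y \<Longrightarrow> \<exists>d\<in>D. d x \<noteq> d y"
  shows "metrizable_space (top_of_set K)"
proof -
  \<comment> \<open>The constant 0 keeps the family nonempty, so \<open>from_nat_into\<close> takes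
    values only in it.\<close>
  define D' where "D' = insert (\<lambda>_. 0) D"
  have D': "countable D'" "D' \<noteq> {}" "\<And>d. d \<in> D' \<Longrightarrow> continuous_on K d"
    using D by (auto simp: D'_def)
  define \<phi> where "\<phi> z n = from_nat_into D' n z" for z n
  have "continuous_on K \<phi>"
    by (rule continuous_on_coordinatewise_then_product)
       (use D'(3) from_nat_into[OF D'(2)] in \<open>auto simp: \<phi>_def\<close>)
  moreover have "inj_on \<phi> K"
  proof (rule inj_onI, rule ccontr)
    fix x y assume xy: "x \<in> K" "y \<in> K" "\<phi> x = \<phi> y" "x \<noteq> y"
    then obtain d where d: "d \<in> D'" "d x \<noteq> d y" using sep by (auto simp: D'_def)
    then obtain n where "d = from_nat_into D' n"
      using subset_range_from_nat_into[OF D'(1)] by blast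
    then show False using d(2) fun_cong[OF xy(3), of n] by (simp add: \<phi>_def)
  qed
  ultimately obtain \<psi> where "homeomorphism K (\<phi> ` K) \<phi> \<psi>"
    using homeomorphism_compact[OF K] by blast
  then have "homeomorphic_maps (top_of_set K) (top_of_set (\<phi> ` K)) \<phi> \<psi>"
    by (auto simp: homeomorphism_def homeomorphic_maps_def)
  then have "top_of_set K homeomorphic_space top_of_set (\<phi> ` K)"
    unfolding homeomorphic_space_def by blast
  moreover have "metrizable_space (top_of_set (\<phi> ` K))"
    by (intro metrizable_space_subtopology metrizable_space_euclidean)
  ultimately show ?thesis using homeomorphic_metrizable_space by blast
qed

section \<open>Pointwise convergence on a boundary\<close>

lemma summable_bounded_half_powers:
  fixes g :: "nat \<Rightarrow> real"
  assumes "\<And>k. \<bar>g k\<bar> \<le> M"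
  shows "summable (\<lambda>k. g k / 2 ^ Suc k)"
proof (rule summable_comparison_test)
  show "\<exists>N. \<forall>n\<ge>N. norm (g n / 2 ^ Suc n) \<le> M * (1 / 2) ^ Suc n"
    using assms by (auto simp: abs_divide divide_simps power_one_over)
  show "summable (\<lambda>n. M * (1 / 2) ^ Suc n)"
    using power_half_series by (intro summable_mult) (rule sums_summable)
qed

text \<open>The weights add up to 1, so the weighted series are infinite convex combinations and
  preserve upper and lower bounds.\<close>

lemma suminf_half_powers_const: "(\<Sum>k. c / 2 ^ Suc k) = (c :: real)"
  using sums_unique[OF sums_mult[OF power_half_series, of c]] by (simp add: power_one_over field_simps)

lemma suminf_half_powers_le:
  fixes g :: "nat \<Rightarrow> real"
  assumes "\<And>k. \<bar>g k\<bar> \<le> M" "\<And>k. g k \<le> c"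
  shows "(\<Sum>k. g k / 2 ^ Suc k) \<le> c"
proof -
  have "(\<Sum>k. g k / 2 ^ Suc k) \<le> (\<Sum>k. c / 2 ^ Suc k)"
    using summable_bounded_half_powers[of g M] summable_bounded_half_powers[of "\<lambda>_. c" "\<bar>c\<bar>"] assms
    by (intro suminf_le divide_right_mono) auto
  then show ?thesis by (simp only: suminf_half_powers_const)
qed

lemma suminf_half_powers_ge:
  fixes g :: "nat \<Rightarrow> real"
  assumes "\<And>k. \<bar>g k\<bar> \<le> M" "\<And>k. c \<le> g k"
  shows "c \<le> (\<Sum>k. g k / 2 ^ Suc k)"
proof -
  have "(\<Sum>k. c / 2 ^ Suc k) \<le> (\<Sum>k. g k / 2 ^ Suc k)"
    using summable_bounded_half_powers[of g M] summable_bounded_half_powers[of "\<lambda>_. c" "\<bar>c\<bar>"] assms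
    by (intro suminf_le divide_right_mono) auto
  then show ?thesis by (simp only: suminf_half_powers_const)
qed

text \<open>The Weierstrass test makes the convergence uniform, which preserves continuity; affinity
  passes through the series termwise.\<close>

lemma continuous_affine_funs_suminf:
  assumes g: "\<And>k. g k \<in> continuous_affine_funs K"
    and bd: "\<And>k z. z \<in> K \<Longrightarrow> \<bar>g k z\<bar> \<le> M" and K: "convex K"
  shows "(\<lambda>z. \<Sum>k. g k z / 2 ^ Suc k) \<in> continuous_affine_funs K"
proof -
  have "continuous_on K (\<lambda>z. \<Sum>k. g k z / 2 ^ Suc k)"
  proof (rule uniform_limit_theorem)
    show "uniform_limit K (\<lambda>n z. \<Sum>k<n. g k z / 2 ^ Suc k) (\<lambda>z. \<Sum>k. g k z / 2 ^ Suc k) sequentially"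
    proof (rule Weierstrass_m_test)
      show "norm (g n z / 2 ^ Suc n) \<le> M / 2 ^ Suc n" if "z \<in> K" for n z
        using bd[OF that, of n] by (simp add: abs_divide divide_right_mono)
      show "summable (\<lambda>n. M / 2 ^ Suc n)"
        by (rule summable_bounded_half_powers[of "\<lambda>_. M" "\<bar>M\<bar>"]) simp
    qed
    show "\<forall>\<^sub>F n in sequentially. continuous_on K (\<lambda>z. \<Sum>k<n. g k z / 2 ^ Suc k)"
      using g by (intro always_eventually allI continuous_intros) (auto simp: continuous_affine_funs_def)
  qed simp
  moreover have "affine_fun_on K (\<lambda>z. \<Sum>k. g k z / 2 ^ Suc k)"
    unfolding affine_fun_on_def
  proof (intro ballI)
    fix x y and t :: real assume xy: "x \<in> K" "y \<in> K" "t \<in> {0..1}"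
    have sm: "summable (\<lambda>k. g k z / 2 ^ Suc k)" if "z \<in> K" for z
      using bd[OF that] by (rule summable_bounded_half_powers)
    have "g k ((1 - t) *\<^sub>R x + t *\<^sub>R y) = (1 - t) * g k x + t * g k y" for k
      using g[of k] xy by (auto simp: continuous_affine_funs_def affine_fun_on_def)
    then have "(\<lambda>k. g k ((1 - t) *\<^sub>R x + t *\<^sub>R y) / 2 ^ Suc k)
        = (\<lambda>k. (1 - t) * (g k x / 2 ^ Suc k) + t * (g k y / 2 ^ Suc k))"
      by (simp add: add_divide_distrib)
    then show "(\<Sum>k. g k ((1 - t) *\<^sub>R x + t *\<^sub>R y) / 2 ^ Suc k)
        = (1 - t) * (\<Sum>k. g k x / 2 ^ Suc k) + t * (\<Sum>k. g k y / 2 ^ Suc k)"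
      using sm[OF xy(1)] sm[OF xy(2)]
      by (simp only: suminf_add[symmetric] suminf_mult summable_mult)
  qed
  ultimately show ?thesis by (simp add: continuous_affine_funs_def)
qed

section \<open>Simons' argument for tails of a series\<close>

lemma exists_almost_minimizer:
  fixes \<phi> :: "'b \<Rightarrow> real"
  assumes "C \<noteq> {}" "\<And>g. g \<in> C \<Longrightarrow> m \<le> \<phi> g" "e > 0"
  obtains g where "g \<in> C" "\<And>g'. g' \<in> C \<Longrightarrow> \<phi> g \<le> \<phi> g' + e"
proof -
  have bdd: "bdd_below (\<phi> ` C)" using assms(2) by (intro bdd_belowI2[where m = m])
  have "Inf (\<phi> ` C) < Inf (\<phi> ` C) + e" using assms(3) by simp
  then obtain g where g: "g \<in> C" "\<phi> g < Inf (\<phi> ` C) + e"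
    using cInf_lessD[of "\<phi> ` C" "Inf (\<phi> ` C) + e"] assms(1) by auto
  have "\<phi> g \<le> \<phi> g' + e" if "g' \<in> C" for g'
    using g(2) cINF_lower[OF bdd that] by simp
  with g(1) that show ?thesis by blast
qed

text \<open>The functional \<open>S\<close> below is the supremum over \<open>K\<close>. Writing \<open>v\<^sub>m\<close> for the partial sums,
  \<open>v\<^sub>m + g\<^sub>m / 2\<^sup>m = 2 v\<^sub>m\<^sub>+\<^sub>1 - v\<^sub>m\<close> is almost minimal among the competitors
  \<open>v\<^sub>m + g / 2\<^sup>m\<close>, one of which is the full sum \<open>v\<close>. Hence
  \<open>S v - S v\<^sub>m\<close> shrinks by a factor of at most 2 in each step, up to a small error, and at a point where \<open>v\<close>
  attains its maximum every tail is almost as large as \<open>S v\<close>.\<close>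

lemma Simons_tails:
  fixes K :: "'a::{real_vector,topological_space} set"
  assumes K: "convex K" and B: "boundary_of_convex K B"
    and x: "x \<in> K" and \<epsilon>: "\<epsilon> > 0"
    and CA: "\<And>m. C m \<subseteq> continuous_affine_funs K"
    and ne: "\<And>m. C m \<noteq> {}"
    and bd: "\<And>m g z. g \<in> C m \<Longrightarrow> z \<in> K \<Longrightarrow> \<bar>g z\<bar> \<le> M"
    and sigma: "\<And>m g. (\<And>k. g k \<in> C (m + k)) \<Longrightarrow> (\<lambda>z. \<Sum>k. g k z / 2 ^ Suc k) \<in> C m"
  obtains b y where "b \<in> B" "\<And>m. y m \<in> C m" "\<And>m. y m b \<ge> y 0 x - \<epsilon>"
proof -
  define S where "S f = Sup (f ` K)" for f :: "'a \<Rightarrow> real"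
  have S_upper: "f z \<le> S f" if "z \<in> K" "\<And>w. w \<in> K \<Longrightarrow> f w \<le> c" for f z c
    unfolding S_def using that by (intro cSup_upper bdd_aboveI2[where M = c]) auto
  have S_least: "S f \<le> c" if "\<And>w. w \<in> K \<Longrightarrow> f w \<le> c" for f c
    unfolding S_def using that x by (intro cSup_least) auto
  define bounded where "bounded v \<longleftrightarrow> (\<exists>c. \<forall>z\<in>K. \<bar>v z\<bar> \<le> c)" for v :: "'a \<Rightarrow> real"
  \<comment> \<open>The trial weight 1/2^m is the total weight of the tail still to be chosen; the
    update of v adds g with only half of it. The tolerance fits the gap estimate below: multiplied
    by 2^(m+1), stage m costs \<epsilon>/2^(m+2), and these costs sum to less than
    \<epsilon>.\<close>
  define next_step where "next_step m v g \<longleftrightarrow> g \<in> C m \<and> (\<forall>g'\<in>C m.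
      S (\<lambda>z. v z + g z / 2 ^ m) \<le> S (\<lambda>z. v z + g' z / 2 ^ m) + \<epsilon> / 4 ^ Suc m)"
    for m :: nat and v g :: "'a \<Rightarrow> real"
  have bounded_step: "bounded (\<lambda>z. v z + g z / c)" if "bounded v" "g \<in> C m" for v g m c
  proof -
    obtain d where d: "\<And>z. z \<in> K \<Longrightarrow> \<bar>v z\<bar> \<le> d" using \<open>bounded v\<close> by (auto simp: bounded_def)
    have "\<bar>v z + g z / c\<bar> \<le> d + M / \<bar>c\<bar>" if "z \<in> K" for z
    proof -
      have "\<bar>v z + g z / c\<bar> \<le> \<bar>v z\<bar> + \<bar>g z\<bar> / \<bar>c\<bar>" using abs_triangle_ineq[of "v z" "g z / c"] by simp
      also have "\<dots> \<le> d + M / \<bar>c\<bar>"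
        using d[OF that] bd[OF \<open>g \<in> C m\<close> that] by (intro add_mono divide_right_mono) auto
      finally show ?thesis .
    qed
    then show ?thesis unfolding bounded_def by blast
  qed
  have S_ge: "f z \<le> S f" if "bounded f" "z \<in> K" for f z
    using that S_upper[of z f] unfolding bounded_def by (metis abs_le_D1)
  have step: "\<exists>g. next_step m v g" if v: "bounded v" for m v
  proof -
    have "v x - M / 2 ^ m \<le> S (\<lambda>z. v z + g z / 2 ^ m)" if g: "g \<in> C m" for g
    proof -
      have "\<bar>g x / 2 ^ m\<bar> \<le> M / 2 ^ m"
        using bd[OF g x] by (simp add: abs_divide divide_right_mono)
      then show ?thesis using S_ge[OF bounded_step[OF v g] x, of "2 ^ m"] by linarith
    qed
    then obtain g where "g \<in> C m" "\<And>g'. g' \<in> C m \<Longrightarrow>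
        S (\<lambda>z. v z + g z / 2 ^ m) \<le> S (\<lambda>z. v z + g' z / 2 ^ m) + \<epsilon> / 4 ^ Suc m"
      using exists_almost_minimizer[OF ne[of m], of "v x - M / 2 ^ m" "\<lambda>g. S (\<lambda>z. v z + g z / 2 ^ m)"
          "\<epsilon> / 4 ^ Suc m"] \<epsilon> by auto
    then show ?thesis unfolding next_step_def by blast
  qed
  \<comment> \<open>Boundedness is carried along because the supremum \<open>S\<close> is meaningful
    only for functions bounded on K; the clause for m = 0 fixes the start.\<close>
  have "\<exists>v. \<forall>m. (bounded (v m) \<and> (m = 0 \<longrightarrow> v m = (\<lambda>_. 0))) \<and>
      (\<exists>g. next_step m (v m) g \<and> v (Suc m) = (\<lambda>z. v m z + g z / 2 ^ Suc m))"
  proof (rule dependent_nat_choice)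
    show "\<exists>v. bounded v \<and> (0 = 0 \<longrightarrow> v = (\<lambda>_. 0))" unfolding bounded_def by auto
    fix v and m :: nat assume v: "bounded v \<and> (m = 0 \<longrightarrow> v = (\<lambda>_. 0))"
    then obtain g where g: "next_step m v g" using step by blast
    then have "bounded (\<lambda>z. v z + g z / 2 ^ Suc m)"
      using v bounded_step[of v g m] by (simp add: next_step_def)
    with g show "\<exists>w. (bounded w \<and> (Suc m = 0 \<longrightarrow> w = (\<lambda>_. 0))) \<and>
        (\<exists>g. next_step m v g \<and> w = (\<lambda>z. v z + g z / 2 ^ Suc m))" by blast
  qed
  then obtain v where v_bdd: "\<And>m. bounded (v m)" and v0: "v 0 = (\<lambda>_. 0)"
    and "\<And>m. \<exists>g. next_step m (v m) g \<and> v (Suc m) = (\<lambda>z. v m z + g z / 2 ^ Suc m)"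
    by metis
  then obtain g where g: "\<And>m. next_step m (v m) (g m)"
    and v_Suc: "\<And>m. v (Suc m) = (\<lambda>z. v m z + g m z / 2 ^ Suc m)"
    by metis
  have gC: "g m \<in> C m" for m using g by (simp add: next_step_def)
  define y where "y m z = (\<Sum>k. g (m + k) z / 2 ^ Suc k)" for m z
  have yC: "y m \<in> C m" for m
    using sigma[of "\<lambda>k. g (m + k)" m] gC unfolding y_def[abs_def] by simp
  have split: "y 0 z = v m z + y m z / 2 ^ m" if z: "z \<in> K" for m z
  proof -
    have "v m z = (\<Sum>k<m. g k z / 2 ^ Suc k)"
      by (induction m) (simp_all add: v0 v_Suc)
    moreover have sm: "summable (\<lambda>k. g (m + k) z / 2 ^ Suc k)" for m
      using bd[OF gC z] by (rule summable_bounded_half_powers)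
    have "y m z / 2 ^ m = (\<Sum>k. g (m + k) z / 2 ^ Suc k / 2 ^ m)"
      unfolding y_def by (rule suminf_divide[OF sm, symmetric])
    then have "y m z / 2 ^ m = (\<Sum>k. g (k + m) z / 2 ^ Suc (k + m))"
      by (simp add: power_add add.commute mult.assoc)
    ultimately show ?thesis
      using suminf_split_initial_segment[OF sm[of 0], of m] unfolding y_def by simp
  qed
  have y0: "bounded (y 0)" using bd[OF yC] unfolding bounded_def by blast
  have halving: "2 * S (v (Suc m)) \<le> S (y 0) + S (v m) + \<epsilon> / 4 ^ Suc m" for m
  proof -
    let ?w = "\<lambda>z. v m z + g m z / 2 ^ m"
    have "S (\<lambda>z. v m z + y m z / 2 ^ m) = S (y 0)"
      unfolding S_def using split by (intro arg_cong[of _ _ Sup] image_cong) auto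
    then have w: "S ?w \<le> S (y 0) + \<epsilon> / 4 ^ Suc m"
      using g[of m, unfolded next_step_def, THEN conjunct2, rule_format, OF yC[of m]] by simp
    have "v (Suc m) z \<le> (S ?w + S (v m)) / 2" if z: "z \<in> K" for z
    proof -
      have "?w z \<le> S ?w" by (rule S_ge[OF bounded_step[OF v_bdd gC] z])
      moreover have "v m z \<le> S (v m)" by (rule S_ge[OF v_bdd z])
      moreover have "v (Suc m) z = (?w z + v m z) / 2" by (simp add: v_Suc field_simps)
      ultimately show ?thesis by simp
    qed
    then have "S (v (Suc m)) \<le> (S ?w + S (v m)) / 2" by (rule S_least)
    with w show ?thesis by simp
  qed
  \<comment> \<open>The summand \<epsilon>/2^m is the part of the tolerance not yet spent; at m = 0
    the claim reduces to S (v 0) <= 0.\<close>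
  have gap: "(S (y 0) - \<epsilon> + \<epsilon> / 2 ^ m) / 2 ^ m \<le> S (y 0) - S (v m)" for m
  proof (induction m)
    case 0
    have "S (v 0) \<le> 0" by (rule S_least) (simp add: v0)
    then show ?case by simp
  next
    case (Suc m)
    define p :: real where "p = 2 ^ m"
    have p: "p \<ge> 1" by (simp add: p_def)
    have p4: "4 ^ m = p * p" by (simp add: p_def flip: power_mult_distrib)
    have IH: "(S (y 0) - \<epsilon> + \<epsilon> / p) / p \<le> S (y 0) - S (v m)" using Suc by (simp add: p_def)
    have "(S (y 0) - \<epsilon> + \<epsilon> / (2 * p)) / (2 * p) =
        ((S (y 0) - \<epsilon> + \<epsilon> / p) / p - \<epsilon> / (2 * (p * p))) / 2"
      using p by (simp add: field_simps)
    also have "\<dots> \<le> (S (y 0) - S (v m) - \<epsilon> / (4 * (p * p))) / 2"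
    proof -
      have "\<epsilon> / (4 * (p * p)) \<le> \<epsilon> / (2 * (p * p))" using \<epsilon> p by (intro divide_left_mono) auto
      with IH show ?thesis by (intro divide_right_mono diff_mono) auto
    qed
    also have "\<dots> \<le> S (y 0) - S (v (Suc m))" using halving[of m] by (simp add: p4)
    finally show ?case by (simp add: p_def)
  qed
  \<comment> \<open>The boundary property enters here: the full sum \<open>y 0\<close> attains its
    maximum over K at b in B. Since v m b <= S (v m), the gap estimate then bounds y m b / 2^m from
    below.\<close>
  obtain b where b: "b \<in> B" "\<And>z. z \<in> K \<Longrightarrow> y 0 z \<le> y 0 b"
    using B yC[of 0] CA[of 0] unfolding boundary_of_convex_def by blast
  have bK: "b \<in> K" using b(1) B by (auto simp: boundary_of_convex_def)
  have Sb: "S (y 0) \<le> y 0 b" using b(2) by (rule S_least)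
  have "y 0 x - \<epsilon> \<le> y m b" for m
  proof -
    have "(y 0 x - \<epsilon>) / 2 ^ m \<le> (S (y 0) - \<epsilon> + \<epsilon> / 2 ^ m) / 2 ^ m"
      using S_ge[OF y0 x] \<epsilon> by (intro divide_right_mono) (auto intro: add_increasing2)
    also have "\<dots> \<le> S (y 0) - S (v m)" by (rule gap)
    also have "\<dots> \<le> y 0 b - v m b" using Sb S_ge[OF v_bdd bK, of m] by simp
    also have "\<dots> = y m b / 2 ^ m" using split[OF bK, of m] by simp
    finally show ?thesis by (simp add: divide_le_cancel)
  qed
  with b(1) yC show ?thesis by (rule that)
qed

section \<open>From tails to pointwise convergence\<close>

text \<open>If h n x >= \<delta> for all n, the tails yield b in B and functions \<open>y m\<close>
  with y m b >= \<delta>/2. Yet y m b is at most the supremum of h k b over k >= m, which is small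
  for large m.\<close>

lemma boundary_null_sequence_not_bounded_below:
  fixes K :: "'a::{real_vector,topological_space} set"
  assumes K: "convex K" and B: "boundary_of_convex K B"
    and h: "\<And>n. h n \<in> continuous_affine_funs K"
    and bd: "\<And>n z. z \<in> K \<Longrightarrow> \<bar>h n z\<bar> \<le> M"
    and lim: "\<And>b. b \<in> B \<Longrightarrow> (\<lambda>n. h n b) \<longlonglongrightarrow> 0"
    and x: "x \<in> K" and \<delta>: "\<delta> > 0"
  shows "\<exists>n. h n x < \<delta>"
proof (rule ccontr)
  assume "\<nexists>n. h n x < \<delta>"
  then have ge: "\<delta> \<le> h n x" for n by (simp add: not_less)
  \<comment> \<open>The clause on c says that f is at most the supremum of the h k with k >= m,
    pointwise on K. It stands in for membership in the infinite convex hull of that tail and passes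
    directly to the weighted series.\<close>
  define C where "C m = {f \<in> continuous_affine_funs K. (\<forall>z\<in>K. \<bar>f z\<bar> \<le> M) \<and> \<delta> \<le> f x \<and>
      (\<forall>z\<in>K. \<forall>c. (\<forall>k\<ge>m. h k z \<le> c) \<longrightarrow> f z \<le> c)}" for m
  have sigma: "(\<lambda>z. \<Sum>k. g k z / 2 ^ Suc k) \<in> C m" if g: "\<And>k. g k \<in> C (m + k)" for m g
  proof -
    have gbd: "\<bar>g k z\<bar> \<le> M" if "z \<in> K" for k z using g[of k] that by (auto simp: C_def)
    have "(\<lambda>z. \<Sum>k. g k z / 2 ^ Suc k) \<in> continuous_affine_funs K"
      using g gbd K by (intro continuous_affine_funs_suminf[where M = M]) (auto simp: C_def)
    moreover have "\<bar>\<Sum>k. g k z / 2 ^ Suc k\<bar> \<le> M" if z: "z \<in> K" for z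
    proof (rule abs_leI)
      show "(\<Sum>k. g k z / 2 ^ Suc k) \<le> M"
        using gbd[OF z] by (intro suminf_half_powers_le[where M = M]) (auto simp: abs_le_iff)
      have "- M \<le> (\<Sum>k. g k z / 2 ^ Suc k)"
      proof (rule suminf_half_powers_ge)
        show "- M \<le> g k z" for k using gbd[OF z, of k] by (simp add: abs_le_iff)
      qed (rule gbd[OF z])
      then show "- (\<Sum>k. g k z / 2 ^ Suc k) \<le> M" by simp
    qed
    moreover have "\<delta> \<le> (\<Sum>k. g k x / 2 ^ Suc k)"
      using gbd[OF x] g by (intro suminf_half_powers_ge[where M = M]) (auto simp: C_def)
    moreover have "(\<Sum>k. g k z / 2 ^ Suc k) \<le> c"
      if z: "z \<in> K" and c: "\<forall>k\<ge>m. h k z \<le> c" for z c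
    proof (rule suminf_half_powers_le)
      show "g k z \<le> c" for k
      proof -
        have "\<forall>j\<ge>m + k. h j z \<le> c" using c by simp
        then show ?thesis using g[of k] z by (simp add: C_def)
      qed
    qed (rule gbd[OF z])
    ultimately show ?thesis by (simp add: C_def)
  qed
  have ne: "C m \<noteq> {}" for m
  proof -
    have "h m \<in> C m" using h bd ge by (auto simp: C_def)
    then show ?thesis by blast
  qed
  have CA: "C m \<subseteq> continuous_affine_funs K" for m by (auto simp: C_def)
  obtain b y where b: "b \<in> B" and y: "\<And>m. y m \<in> C m" "\<And>m. y m b \<ge> y 0 x - \<delta> / 2"
  proof (rule Simons_tails[where C = C, OF K B x half_gt_zero[OF \<delta>] CA ne])
    show "\<bar>f z\<bar> \<le> M" if "f \<in> C m" "z \<in> K" for m f z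
      using that by (auto simp: C_def)
  next
    fix m and g :: "nat \<Rightarrow> 'a \<Rightarrow> real"
    assume "\<And>k. g k \<in> C (m + k)"
    then show "(\<lambda>z. \<Sum>k. g k z / 2 ^ Suc k) \<in> C m" by (rule sigma)
  qed (rule that)
  \<comment> \<open>Any positive bound below \<delta>/2, the lower bound for every y m b, would
    do.\<close>
  have "\<forall>\<^sub>F n in sequentially. h n b < \<delta> / 4"
    using lim[OF b] \<delta> by (intro order_tendstoD) auto
  then obtain m where "\<forall>k\<ge>m. h k b \<le> \<delta> / 4"
    by (auto simp: eventually_sequentially intro: less_imp_le)
  moreover have "b \<in> K" using b B by (auto simp: boundary_of_convex_def)
  ultimately have "y m b \<le> \<delta> / 4" using y(1)[of m] unfolding C_def by blast
  moreover have "\<delta> \<le> y 0 x" using y(1)[of 0] by (simp add: C_def)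
  ultimately show False using y(2)[of m] \<delta> by simp
qed

lemma continuous_affine_funs_lincomb:
  assumes "f \<in> continuous_affine_funs K" "g \<in> continuous_affine_funs K"
  shows "(\<lambda>z. a * f z + b * g z) \<in> continuous_affine_funs K"
proof -
  have "affine_fun_on K (\<lambda>z. a * f z + b * g z)"
    unfolding affine_fun_on_def
  proof (intro ballI)
    fix x y and t :: real assume "x \<in> K" "y \<in> K" "t \<in> {0..1}"
    then have "f ((1 - t) *\<^sub>R x + t *\<^sub>R y) = (1 - t) * f x + t * f y"
        "g ((1 - t) *\<^sub>R x + t *\<^sub>R y) = (1 - t) * g x + t * g y"
      using assms unfolding continuous_affine_funs_def affine_fun_on_def by blast+
    then show "a * f ((1 - t) *\<^sub>R x + t *\<^sub>R y) + b * g ((1 - t) *\<^sub>R x + t *\<^sub>R y)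
        = (1 - t) * (a * f x + b * g x) + t * (a * f y + b * g y)"
      by (simp only:) (simp add: algebra_simps)
  qed
  then show ?thesis using assms by (auto simp: continuous_affine_funs_def intro!: continuous_intros)
qed

text \<open>Failure of convergence gives a sign s and a subsequence along which s (d n x - f x) >=
  \<delta>. These signed differences are uniformly bounded, affine and null on B, which contradicts
  the one-sided result above.\<close>

lemma boundary_pointwise_convergence:
  fixes K :: "'a::{real_vector,topological_space} set"
  assumes K: "convex K" and B: "boundary_of_convex K B"
    and d: "\<And>n. d n \<in> continuous_affine_funs K" and f: "f \<in> continuous_affine_funs K"
    and bd: "\<And>n z. z \<in> K \<Longrightarrow> \<bar>d n z\<bar> \<le> M" and bdf: "\<And>z. z \<in> K \<Longrightarrow> \<bar>f z\<bar> \<le> M"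
    and lim: "\<And>b. b \<in> B \<Longrightarrow> (\<lambda>n. d n b) \<longlonglongrightarrow> f b"
    and x: "x \<in> K"
  shows "(\<lambda>n. d n x) \<longlonglongrightarrow> f x"
proof (rule tendstoI)
  fix \<delta> :: real assume \<delta>: "\<delta> > 0"
  have *: "\<forall>\<^sub>F n in sequentially. s * (d n x - f x) < \<delta>" if s: "\<bar>s\<bar> = 1" for s :: real
  proof (rule ccontr)
    assume "\<not> ?thesis"
    then obtain r :: "nat \<Rightarrow> nat" where r: "strict_mono r"
      and ge: "\<And>n. \<not> s * (d (r n) x - f x) < \<delta>"
      using not_eventually_sequentiallyD by blast
    have "\<exists>n. s * (d (r n) x - f x) < \<delta>"
    proof (rule boundary_null_sequence_not_bounded_below[OF K B _ _ _ x \<delta>])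
      show "(\<lambda>z. s * (d (r n) z - f z)) \<in> continuous_affine_funs K" for n
        using continuous_affine_funs_lincomb[OF d f, of s "r n" "- s"] by (simp add: algebra_simps)
      show "\<bar>s * (d (r n) z - f z)\<bar> \<le> 2 * M" if "z \<in> K" for n z
        using bd[OF that, of "r n"] bdf[OF that] s by (simp add: abs_mult)
      show "(\<lambda>n. s * (d (r n) b - f b)) \<longlonglongrightarrow> 0" if "b \<in> B" for b
      proof -
        have "(\<lambda>n. d (r n) b) \<longlonglongrightarrow> f b"
          using LIMSEQ_subseq_LIMSEQ[OF lim[OF that] r] by (simp add: o_def)
        then show ?thesis by (auto intro!: tendsto_eq_intros)
      qed
    qed
    with ge show False by blast
  qed
  show "\<forall>\<^sub>F n in sequentially. dist (d n x) (f x) < \<delta>"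
    using *[of 1, simplified] *[of "- 1", simplified]
    by eventually_elim (simp add: dist_real_def abs_less_iff)
qed

section \<open>Metrizability\<close>

theorem mainTheorem1:
  fixes K B :: "'a::locally_convex_space set"
  assumes "compact K" and "convex K"
    and "boundary_of_convex K B"
    and "\<exists>\<N>. countable \<N> \<and> network_of (top_of_set B) \<N>"
  shows "metrizable_space (top_of_set K)"
proof -
  obtain \<N> where \<N>: "countable \<N>" "network_of (top_of_set B) \<N>" using assms(4) by blast
  have BK: "B \<subseteq> K" using assms(3) by (simp add: boundary_of_convex_def)
  \<comment> \<open>The unit ball supplies the uniform bound required to carry convergence from B to
    K, and by scaling it still separates points.\<close>
  define \<F> where "\<F> = {f \<in> continuous_affine_funs K. \<forall>z\<in>K. \<bar>f z\<bar> \<le> 1}"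
  have \<F>: "f \<in> continuous_affine_funs K" "continuous_on K f" "\<And>z. z \<in> K \<Longrightarrow> \<bar>f z\<bar> \<le> 1" if "f \<in> \<F>" for f
    using that by (auto simp: \<F>_def continuous_affine_funs_def)
  have contB: "continuous_on B f" if "f \<in> \<F>" for f
    using \<F>(2)[OF that] BK by (rule continuous_on_subset)
  obtain D where D: "countable D" "D \<subseteq> \<F>"
    and dense: "\<And>f. f \<in> \<F> \<Longrightarrow> \<exists>d. range d \<subseteq> D \<and> (\<forall>b\<in>B. (\<lambda>n. d n b) \<longlonglongrightarrow> f b)"
    using countable_sequentially_dense_on_countable_network[OF \<N> contB] by blast
  show ?thesis
  proof (rule metrizable_of_countable_separating[OF assms(1) D(1)])
    show "continuous_on K d" if "d \<in> D" for d using that D(2) \<F>(2) by blast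
    fix x y assume xy: "x \<in> K" "y \<in> K" "x \<noteq> y"
    obtain f where f: "f \<in> \<F>" "f x \<noteq> f y"
      using bounded_continuous_affine_separates[OF assms(1) xy] unfolding \<F>_def by blast
    obtain d where d: "\<And>n. d n \<in> D" and lim: "\<And>b. b \<in> B \<Longrightarrow> (\<lambda>n. d n b) \<longlonglongrightarrow> f b"
      using dense[OF f(1)] by blast
    have d\<F>: "d n \<in> \<F>" for n using d D(2) by blast
    have "(\<lambda>n. d n z) \<longlonglongrightarrow> f z" if "z \<in> K" for z
      using assms(2,3) \<F>(1)[OF d\<F>] \<F>(1)[OF f(1)] \<F>(3)[OF d\<F>] \<F>(3)[OF f(1)] lim that
      by (rule boundary_pointwise_convergence)
    with xy have "(\<lambda>n. d n x) \<longlonglongrightarrow> f x" "(\<lambda>n. d n y) \<longlonglongrightarrow> f y" by auto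
    \<comment> \<open>If every d n agreed at x and y, the limits f x and f y would coincide.\<close>
    with f(2) have "\<exists>n. d n x \<noteq> d n y" using LIMSEQ_unique by (metis ext)
    with d show "\<exists>d\<in>D. d x \<noteq> d y" by blast
  qed
qed

end
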